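(* Let $d\in\mathbb{N}$ and let $(\omega_j)_{j\in\mathbb{N}}$ be weight functions on $\mathbb{R}^{d+1}$ whose moments $$a_{j\boldsymbol{k}}=\int_{\mathbb{R}^{d+1}}\boldsymbol{t}^{\boldsymbol{k}}\,\omega_j(\boldsymbol{t})\,d\boldsymbol{t},\qquad \boldsymbol{k}\in\mathbb{N}^{d+1},$$ exist and satisfy $a_{0\boldsymbol{k}}=a_{1\boldsymbol{k}}=:a_{\boldsymbol{k}}$ for all $\boldsymbol{k}$. Let $\mathbf{E}\colon\mathbb{R}[\boldsymbol{x}]\to\mathbb{R}$ be the linear functional with $\mathbf{E}\,\boldsymbol{x}_0^{\boldsymbol{k}}=a_{\boldsymbol{k}}$ and $\mathbf{E}\,\boldsymbol{x}_i^{\boldsymbol{k}}=a_{j\boldsymbol{k}}$ for $i\in\mathbb{P}_j$, multiplicative over distinct $\boldsymbol{x}_i$'s, and let $\mathbf{E}_0\colon\mathbb{R}[\boldsymbol{x}]\to\mathbb{R}[\boldsymbol{x}_0]$ be the associated operator that fixes $\mathbb{R}[\boldsymbol{x}_0]$ pointwise and acts on the remaining indeterminates as $\mathbf{E}$ does. For $\boldsymbol{0}<\boldsymbol{m}\le\boldsymbol{n}$ in $\mathbb{N}^{d+1}$ let $s=s(\boldsymbol{n})-1$, $r=s(\boldsymbol{n}-\boldsymbol{m})-1$, assume $1,2,\ldots,r\in\mathbb{P}_1$, let $$p_{\boldsymbol{n}\boldsymbol{m}}(\boldsymbol{x}_0)=\mathbf{E}_0\,\boldsymbol{\Delta}^*_{\boldsymbol{n}-\boldsymbol{m}}(\boldsymbol{x}_1,\ldots,\boldsymbol{x}_r)\,\boldsymbol{\Delta}_{\boldsymbol{n}}(\boldsymbol{x}_0,\boldsymbol{x}_1,\ldots,\boldsymbol{x}_s),$$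 and assume that $p_{\boldsymbol{n}\boldsymbol{m}}(\boldsymbol{x}_0)$ is of degree $\boldsymbol{n}$ for all $\boldsymbol{0}<\boldsymbol{m}\leq\boldsymbol{n}$. Then $$p_{\boldsymbol{n}\boldsymbol{m}}(\boldsymbol{x}_0)=\int_{\mathbb{R}^{s(d+1)}}\boldsymbol{\Delta}^*_{\boldsymbol{n}-\boldsymbol{m}}(\boldsymbol{x}_1,\boldsymbol{x}_2,\ldots,\boldsymbol{x}_r)\,\boldsymbol{\Delta}_{\boldsymbol{n}}(\boldsymbol{x}_0,\boldsymbol{x}_1,\ldots,\boldsymbol{x}_s)\prod_{i=1}^{s}\omega_{j(i)}(\boldsymbol{x}_i)\,d\boldsymbol{x}_i,$$ where $j(i)$ denotes the index with $i\in\mathbb{P}_{j(i)}$.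
   Context: $\mathbb{N}$ is the set of nonnegative integers and $\mathbb{P}$ the set of positive integers. For each $i\in\mathbb{N}$, $\boldsymbol{x}_i=(x_{i0},x_{i1},\ldots,x_{id})$ is a tuple of indeterminates, all $x_{ij}$ being independent, $\boldsymbol{x}$ is the set of all of them, and $\boldsymbol{x}_i^{\boldsymbol{k}}=\prod_{j=0}^d x_{ij}^{k_j}$ for $\boldsymbol{k}=(k_0,\ldots,k_d)\in\mathbb{N}^{d+1}$; similarly $\boldsymbol{t}^{\boldsymbol{k}}=\prod_j t_j^{k_j}$ and $d\boldsymbol{t}=dt_0\,dt_1\cdots dt_d$. The order $\leq$ on $\mathbb{N}^{d+1}$ is componentwise; $\boldsymbol{0}<\boldsymbol{m}$ means $\boldsymbol{m}\ne\boldsymbol{0}$. $s(\boldsymbol{n})$ is the cardinality of $\{\boldsymbol{k}\mid\boldsymbol{0}\le\boldsymbol{k}\le\boldsymbol{n}\}$. Existence of moments means each $\boldsymbol{t}^{\boldsymbol{k}}\omega_j(\boldsymbol{t})$ is Lebesgue integrable. Determinants: for $\boldsymbol{n}\in\mathbb{N}^{d+1}$, let $s=s(\boldsymbol{n})-1$ and enumerate $\{\boldsymbol{k}\mid\boldsymbol{0}\le\boldsymbol{k}\le\boldsymbol{n}\}=\{\boldsymbol{0}=\boldsymbol{n}_0,\boldsymbol{n}_1,\ldots,\boldsymbol{n}_s=\boldsymbol{n}\}$. Then $$\boldsymbol{\Delta}_{\boldsymbol{n}}(\boldsymbol{x}_0,\boldsymbol{x}_1,\ldots,\boldsymbol{x}_s)=\det\big(\boldsymbol{x}_i^{\boldsymbol{n}_j}\big)_{0\le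 i,j\le s},\qquad \boldsymbol{\Delta}^*_{\boldsymbol{n}}(\boldsymbol{x}_1,\ldots,\boldsymbol{x}_s)=\det\big(\boldsymbol{x}_i^{\boldsymbol{n}_j}\big)_{1\le i,j\le s}$$ (rows indexed by $i$, columns by $j$; the empty determinant is $1$). $\boldsymbol{\Delta}^*_{\boldsymbol{n}-\boldsymbol{m}}$ is defined in the same way from $\boldsymbol{n}-\boldsymbol{m}$, so it involves $r=s(\boldsymbol{n}-\boldsymbol{m})-1$ tuples. Classes and operators: $\mathbb{P}=\mathbb{P}_0\cup\mathbb{P}_1\cup\mathbb{P}_2\cup\cdots$ is a partition of $\mathbb{P}$ into infinitely many pairwise disjoint infinite classes; the condition $1,2,\ldots,r\in\mathbb{P}_1$ is understood for each pair $(\boldsymbol{n},\boldsymbol{m})$ separately, the partition being allowed to depend on the pair. On polynomials in $\boldsymbol{x}_0,\ldots,\boldsymbol{x}_s$, $\mathbf{E}_0$ is the linear map into $\mathbb{R}[\boldsymbol{x}_0]$ with $\mathbf{E}_0\,\boldsymbol{x}_0^{\boldsymbol{k}_0}\boldsymbol{x}_1^{\boldsymbol{k}_1}\cdots\boldsymbol{x}_s^{\boldsymbol{k}_s}=\boldsymbol{x}_0^{\boldsymbol{k}_0}\prod_{i=1}^s a_{j(i)\boldsymbol{k}_i}$ (exponents $\boldsymbol{k}_i=\boldsymbol{0}$ contribute $a_{j(i)\boldsymbol{0}}$). A polynomial in $\mathbb{R}[\boldsymbol{x}_0]$ is of degree $\boldsymbol{n}$ if it is a linear combination of monomials $\boldsymbol{x}_0^{\boldsymbol{k}}$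 with $\boldsymbol{0}\le\boldsymbol{k}\le\boldsymbol{n}$ and the coefficient of $\boldsymbol{x}_0^{\boldsymbol{n}}$ is nonzero. *)

theory Defs
  imports
    "HOL-Analysis.Analysis"
    "HOL-Library.Poly_Mapping"
    "Jordan_Normal_Form.Determinant"
begin

no_notation Matrix.vec_index (infixl "$" 100)

text \<open>
  The coordinates \<open>0, \<dots>, d\<close> are the elements of a finite type \<open>'d\<close>, so \<open>CARD('d) = d + 1\<close>; the
  multi-indices are the elements of \<^typ>\<open>nat ^ 'd\<close>, whose library order is the componentwise one.
\<close>

definition mpow :: "'a::comm_monoid_mult ^ 'd \<Rightarrow> nat ^ 'd \<Rightarrow> 'a" where
  "mpow x k = (\<Prod>l\<in>UNIV. (x $ l) ^ (k $ l))"

definition box_card :: "nat ^ 'd \<Rightarrow> nat" where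
  "box_card n = card {k. 0 \<le> k \<and> k \<le> n}"

definition enumerates_box :: "(nat \<Rightarrow> nat ^ 'd) \<Rightarrow> nat ^ 'd \<Rightarrow> bool" where
  "enumerates_box f n \<longleftrightarrow>
     bij_betw f {0..box_card n - 1} {k. 0 \<le> k \<and> k \<le> n} \<and> f 0 = 0 \<and> f (box_card n - 1) = n"

text \<open>
  The determinants are polymorphic in the ring of entries, so that the same definition serves for
  indeterminates and for real points. The family \<open>e\<close> provides the enumeration
  \<open>e n 0, e n 1, \<dots>\<close> of the box below each \<open>n\<close>.
\<close>

definition Delta ::
  "(nat ^ 'd \<Rightarrow> nat \<Rightarrow> nat ^ 'd) \<Rightarrow> nat ^ 'd \<Rightarrow> (nat \<Rightarrow> 'a::comm_ring_1 ^ 'd) \<Rightarrow> 'a" where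
  "Delta e n x = (let s = box_card n - 1 in
     Determinant.det (Matrix.mat (s + 1) (s + 1) (\<lambda>(i, j). mpow (x i) (e n j))))"

text \<open>Matrix indices start at 0, while the rows and columns of the reduced determinant start at 1.\<close>

definition Delta_star ::
  "(nat ^ 'd \<Rightarrow> nat \<Rightarrow> nat ^ 'd) \<Rightarrow> nat ^ 'd \<Rightarrow> (nat \<Rightarrow> 'a::comm_ring_1 ^ 'd) \<Rightarrow> 'a" where
  "Delta_star e n x = (let s = box_card n - 1 in
     Determinant.det (Matrix.mat s s (\<lambda>(i, j). mpow (x (i + 1)) (e n (j + 1)))))"

text \<open>
  Polynomials in one tuple of indeterminates are finitely supported functions on multi-indices.
  For polynomials in all the tuples, a monomial is a finitely supported family of multi-indices:
  \<open>\<mu>\<close> stands for the product over \<open>i\<close> of the \<open>i\<close>-th tuple raised to \<open>lookup \<mu> i\<close>. Multiplication in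
  both types is the convolution product of \<open>Poly_Mapping\<close>.
\<close>

type_synonym 'd poly1 = "(nat ^ 'd) \<Rightarrow>\<^sub>0 real"
type_synonym 'd polys = "(nat \<Rightarrow>\<^sub>0 (nat ^ 'd)) \<Rightarrow>\<^sub>0 real"

definition indet :: "nat \<Rightarrow> 'd::finite polys ^ 'd" where
  "indet i = (\<chi> l. Poly_Mapping.single (Poly_Mapping.single i (axis l 1)) 1)"

definition eval_poly :: "'d::finite poly1 \<Rightarrow> real ^ 'd \<Rightarrow> real" where
  "eval_poly p x = (\<Sum>k\<in>Poly_Mapping.keys p. Poly_Mapping.lookup p k * mpow x k)"

definition of_degree :: "'d::finite poly1 \<Rightarrow> nat ^ 'd \<Rightarrow> bool" where
  "of_degree p n \<longleftrightarrow> Poly_Mapping.keys p \<subseteq> {k. 0 \<le> k \<and> k \<le> n} \<and> Poly_Mapping.lookup p n \<noteq> 0"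

definition class_partition :: "(nat \<Rightarrow> nat set) \<Rightarrow> bool" where
  "class_partition P \<longleftrightarrow> (\<Union>j. P j) = {i. 0 < i} \<and> disjoint_family P \<and> (\<forall>j. infinite (P j))"

definition class_index :: "(nat \<Rightarrow> nat set) \<Rightarrow> nat \<Rightarrow> nat" where
  "class_index P i = (THE j. i \<in> P j)"

definition moment :: "(real ^ 'd \<Rightarrow> real) \<Rightarrow> nat ^ 'd \<Rightarrow> real" where
  "moment w k = (LINT t|lebesgue. mpow t k * w t)"

text \<open>
  The operator is taken on polynomials in the tuples \<open>0, \<dots>, s\<close>. Since \<open>a j 0\<close> need not be 1, the
  product runs over all of \<open>1, \<dots>, s\<close>, including the tuples that do not occur in the monomial.
\<close>

definition E0 ::
  "(nat \<Rightarrow> nat ^ 'd \<Rightarrow> real) \<Rightarrow> (nat \<Rightarrow> nat set) \<Rightarrow> nat \<Rightarrow> 'd::finite polys \<Rightarrow> 'd poly1" where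
  "E0 a P s p = (\<Sum>\<mu>\<in>Poly_Mapping.keys p. Poly_Mapping.single (Poly_Mapping.lookup \<mu> 0)
     (Poly_Mapping.lookup p \<mu> * (\<Prod>i=1..s. a (class_index P i) (Poly_Mapping.lookup \<mu> i))))"

lemma mpow_indet:
  "mpow (indet i :: 'd::finite polys ^ 'd) k = Poly_Mapping.single (Poly_Mapping.single i k) 1"
proof -
  have pow: "Poly_Mapping.single \<mu> (1::real) ^ c = Poly_Mapping.single (\<Sum>_<c. \<mu>) 1"
    for \<mu> :: "nat \<Rightarrow>\<^sub>0 (nat ^ 'd)" and c :: nat
    by (induction c) (simp_all add: mult_single add.commute del: sum_constant)
  have scale: "(\<Sum>_<c. Poly_Mapping.single i v) = Poly_Mapping.single i (\<Sum>_<c. v)"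
    for v :: "nat ^ 'd" and c :: nat
    by (induction c) (simp_all add: single_add del: sum_constant)
  have prd: "(\<Prod>l\<in>A. Poly_Mapping.single (f l) (1::real)) = Poly_Mapping.single (\<Sum>l\<in>A. f l) 1"
    if "finite A" for A :: "'d set" and f :: "'d \<Rightarrow> nat \<Rightarrow>\<^sub>0 (nat ^ 'd)"
    using that by (induction rule: finite_induct) (simp_all add: mult_single)
  have sm: "(\<Sum>l\<in>A. Poly_Mapping.single i (v l)) = Poly_Mapping.single i (\<Sum>l\<in>A. v l)"
    if "finite A" for A :: "'d set" and v :: "'d \<Rightarrow> nat ^ 'd"
    using that by (induction rule: finite_induct) (simp_all add: single_add)
  have "(\<Sum>l\<in>UNIV. \<Sum>_<k $ l. axis l 1) = k"
    unfolding Finite_Cartesian_Product.vec_eq_iff by (simp only: sum_component) (simp add: axis_def if_distrib cong: if_cong)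
  then show ?thesis
    by (simp add: mpow_def indet_def pow scale prd sm del: sum_constant)
qed

lemma E0_monomial:
  "E0 a P s (Poly_Mapping.single \<mu> c) = Poly_Mapping.single (Poly_Mapping.lookup \<mu> 0)
     (c * (\<Prod>i=1..s. a (class_index P i) (Poly_Mapping.lookup \<mu> i)))"
  by (cases "c = 0") (simp_all add: E0_def)

lemma E0_add: "E0 a P s (p + q) = E0 a P s p + E0 a P s q"
proof -
  let ?g = "\<lambda>\<mu> c. Poly_Mapping.single (Poly_Mapping.lookup \<mu> 0)
     (c * (\<Prod>i=1..s. a (class_index P i) (Poly_Mapping.lookup \<mu> i)))"
  have ext: "E0 a P s r = (\<Sum>\<mu>\<in>A. ?g \<mu> (Poly_Mapping.lookup r \<mu>))"
    if "finite A" "Poly_Mapping.keys r \<subseteq> A" for r A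
    unfolding E0_def using that
    by (intro sum.mono_neutral_left) (auto simp: in_keys_iff)
  let ?A = "Poly_Mapping.keys p \<union> Poly_Mapping.keys q"
  have "Poly_Mapping.keys (p + q) \<subseteq> ?A" by (rule Poly_Mapping.keys_add)
  then show ?thesis
    using ext[of ?A "p + q"] ext[of ?A p] ext[of ?A q]
    by (simp add: lookup_add single_add distrib_right sum.distrib)
qed

definition p_poly ::
  "(nat ^ 'd \<Rightarrow> nat \<Rightarrow> nat ^ 'd) \<Rightarrow> (nat \<Rightarrow> nat ^ 'd \<Rightarrow> real) \<Rightarrow> (nat \<Rightarrow> nat set) \<Rightarrow>
   nat ^ 'd \<Rightarrow> nat ^ 'd \<Rightarrow> 'd::finite poly1" where
  "p_poly e a P n m = E0 a P (box_card n - 1) (Delta_star e (n - m) indet * Delta e n indet)"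

text \<open>
  Lebesgue measure on the \<open>s\<close>-fold power of \<open>real ^ 'd\<close>. The completion is needed because the weights
  are only assumed Lebesgue measurable.
\<close>

definition lebesgue_power :: "nat \<Rightarrow> (nat \<Rightarrow> real ^ 'd) measure" where
  "lebesgue_power s = completion (\<Pi>\<^sub>M i\<in>{1..s}. lborel)"

end

theory Submission
  imports Defs
begin

text \<open>
  The identity is Fubini's theorem applied to one monomial at a time. The product of the two
  determinants is a finite linear combination of monomials, and the operator \<open>E0\<close> replaces the factor
  of a monomial that belongs to the \<open>i\<close>-th tuple by the moment that integrates that factor against the
  weight with index \<open>class_index P i\<close>. Integrating the whole monomial against the product of the
  weights gives the product of these moments, so both sides agree on monomials
  (\<open>E0_eq_integral\<close>), hence on all polynomials by linearity.

  Two points remain. The determinants in the integrand are formed from real points, those in the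
  polynomial from indeterminates. Substituting points for the indeterminates is a ring homomorphism
  (\<open>comm_ring_hom_mon_sum\<close>) and so commutes with determinants (\<open>hom_Delta\<close>, \<open>hom_Delta_star\<close>).
  Furthermore, the factors are only Lebesgue measurable, whereas the product measure is the completion
  of a product of Borel measures. Each factor is almost everywhere equal to a Borel function, and a
  null set in one coordinate stays null in the product, so Fubini's theorem carries over to the
  completion (\<open>product_integral_prod_completion\<close>).
\<close>

section \<open>Integrals of products over a completed product measure\<close>

text \<open>
  The cylinder over a null set is a box with one side of measure zero. The other sides may have
  infinite measure, but \<open>0 * \<infinity> = 0\<close>.
\<close>

lemma (in product_sigma_finite) AE_PiM_coordinate:
  assumes I: "finite I" "i \<in> I" and ae: "AE t in M i. Q t"
  shows "AE x in PiM I M. Q (x i)"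
proof -
  from ae obtain N where N: "{t \<in> space (M i). \<not> Q t} \<subseteq> N" "N \<in> sets (M i)" "emeasure (M i) N = 0"
    by (auto elim: AE_E)
  define B where "B = (\<lambda>j. if j = i then N else space (M j))"
  have B: "B j \<in> sets (M j)" for j
    using N(2) by (simp add: B_def)
  have "emeasure (PiM I M) (Pi\<^sub>E I B) = (\<Prod>j\<in>I. emeasure (M j) (B j))"
    using I(1) B by (rule emeasure_PiM)
  also have "\<dots> = 0"
    using I N(3) by (intro prod_zero bexI[of _ i]) (auto simp: B_def)
  finally have "Pi\<^sub>E I B \<in> null_sets (PiM I M)"
    using I(1) B by (intro null_setsI sets_PiM_I_finite) auto
  moreover have "{x \<in> space (PiM I M). \<not> Q (x i)} \<subseteq> Pi\<^sub>E I B"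
  proof
    fix x assume "x \<in> {x \<in> space (PiM I M). \<not> Q (x i)}"
    then have x: "x \<in> Pi\<^sub>E I (\<lambda>j. space (M j))" and "\<not> Q (x i)"
      by (auto simp: space_PiM)
    with N(1) I(2) have "x i \<in> N"
      by (auto simp: PiE_iff)
    with x show "x \<in> Pi\<^sub>E I B"
      by (auto simp: PiE_iff B_def)
  qed
  ultimately show ?thesis
    by (rule AE_I')
qed

lemma measurable_completion_cong_AE:
  fixes f g :: "'a \<Rightarrow> 'b::topological_space"
  assumes g: "g \<in> borel_measurable M" and ae: "AE x in M. f x = g x"
  shows "f \<in> borel_measurable (completion M)"
proof (rule measurableI)
  fix A :: "'b set" assume A: "A \<in> sets borel"
  have "g -` A \<inter> space (completion M) \<in> sets (completion M)"
    using measurable_sets[OF g A] by simp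
  moreover have "AE x in completion M. x \<in> g -` A \<inter> space (completion M) \<longleftrightarrow> x \<in> f -` A \<inter> space (completion M)"
    using AE_completion[OF ae] by eventually_elim auto
  ultimately show "f -` A \<inter> space (completion M) \<in> sets (completion M)"
    using completion.in_sets_AE by blast
qed simp

text \<open>
  Replacing each \<open>f i\<close> by an almost everywhere equal function \<open>g i\<close> that is measurable for \<open>M i\<close>
  itself reduces the claim to the uncompleted product, where Fubini's theorem applies. The completion
  on the left is essential: the product of the \<open>f i\<close> is in general not measurable for \<open>PiM I M\<close>.
\<close>

lemma (in product_sigma_finite) product_integral_prod_completion:
  fixes f :: "'i \<Rightarrow> 'a \<Rightarrow> real"
  assumes I: "finite I" and f: "\<And>i. i \<in> I \<Longrightarrow> integrable (completion (M i)) (f i)"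
  shows "integrable (completion (PiM I M)) (\<lambda>x. \<Prod>i\<in>I. f i (x i))" (is "integrable _ ?F")
    and "(LINT x|completion (PiM I M). (\<Prod>i\<in>I. f i (x i))) = (\<Prod>i\<in>I. (LINT t|completion (M i). f i t))"
proof -
  have "\<exists>h. h \<in> borel_measurable (M i) \<and> (AE t in M i. f i t = h t)" if "i \<in> I" for i
    using completion_ex_borel_measurable_real[OF borel_measurable_integrable[OF f[OF that]]] by auto
  then obtain g where g: "g i \<in> borel_measurable (M i)" and ae: "AE t in M i. f i t = g i t"
    if "i \<in> I" for i
    by metis
  have eq: "integrable (M i) (g i)" "(LINT t|completion (M i). f i t) = (LINT t|M i. g i t)"
    if i: "i \<in> I" for i
  proof -
    have g': "g i \<in> borel_measurable (completion (M i))"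
      using g[OF i] by (rule measurable_completion)
    have f': "f i \<in> borel_measurable (completion (M i))"
      using f[OF i] by (rule borel_measurable_integrable)
    note ae' = AE_completion[OF ae[OF i]]
    have "integrable (completion (M i)) (g i)"
      using integrable_cong_AE[OF f' g' ae'] f[OF i] by simp
    then show "integrable (M i) (g i)"
      by (simp add: integrable_completion g[OF i])
    show "(LINT t|completion (M i). f i t) = (LINT t|M i. g i t)"
      using integral_cong_AE[OF f' g' ae'] by (simp add: integral_completion g[OF i])
  qed
  let ?G = "\<lambda>x. \<Prod>i\<in>I. g i (x i)"
  have G: "integrable (PiM I M) ?G" "integral\<^sup>L (PiM I M) ?G = (\<Prod>i\<in>I. integral\<^sup>L (M i) (g i))"
    using I eq(1) by (auto intro: product_integrable_prod product_integral_prod)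
  then have Gm: "?G \<in> borel_measurable (PiM I M)"
    by auto
  have "AE x in PiM I M. \<forall>i\<in>I. f i (x i) = g i (x i)"
    using I ae by (intro AE_finite_allI AE_PiM_coordinate) auto
  then have FG: "AE x in PiM I M. ?F x = ?G x"
    by eventually_elim (auto intro: prod.cong)
  have Fm: "?F \<in> borel_measurable (completion (PiM I M))"
    using Gm FG by (rule measurable_completion_cong_AE)
  have Gm': "?G \<in> borel_measurable (completion (PiM I M))"
    using Gm by (rule measurable_completion)
  show "integrable (completion (PiM I M)) ?F"
    using integrable_cong_AE[OF Fm Gm' AE_completion[OF FG]] G(1) by (simp add: integrable_completion Gm)
  show "integral\<^sup>L (completion (PiM I M)) ?F = (\<Prod>i\<in>I. (LINT t|completion (M i). f i t))"
    using integral_cong_AE[OF Fm Gm' AE_completion[OF FG]] G(2) by (simp add: integral_completion Gm eq(2))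
qed

section \<open>Evaluation of polynomials\<close>

text \<open>
  The linear extension of a function on monomials. If \<open>h\<close> turns sums of exponents into products, it is
  the evaluation homomorphism that sends the monomial with exponent \<open>k\<close> to \<open>h k\<close>.
\<close>

definition mon_sum :: "('k \<Rightarrow> real) \<Rightarrow> ('k \<Rightarrow>\<^sub>0 real) \<Rightarrow> real" where
  "mon_sum h p = (\<Sum>k\<in>Poly_Mapping.keys p. Poly_Mapping.lookup p k * h k)"

lemma mon_sum_superset:
  assumes "finite A" "Poly_Mapping.keys p \<subseteq> A"
  shows "mon_sum h p = (\<Sum>k\<in>A. Poly_Mapping.lookup p k * h k)"
  unfolding mon_sum_def using assms by (intro sum.mono_neutral_left) (auto simp: in_keys_iff)

lemma mon_sum_add: "mon_sum h (p + q) = mon_sum h p + mon_sum h q"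
proof -
  let ?A = "Poly_Mapping.keys p \<union> Poly_Mapping.keys q"
  have "Poly_Mapping.keys (p + q) \<subseteq> ?A"
    by (rule Poly_Mapping.keys_add)
  then show ?thesis
    using mon_sum_superset[of ?A "p + q" h] mon_sum_superset[of ?A p h] mon_sum_superset[of ?A q h]
    by (simp add: lookup_add distrib_right sum.distrib)
qed

lemma mon_sum_0 [simp]: "mon_sum h 0 = 0"
  by (simp add: mon_sum_def)

lemma mon_sum_single [simp]: "mon_sum h (Poly_Mapping.single k c) = c * h k"
  by (simp add: mon_sum_def)

lemma mon_sum_sum: "mon_sum h (\<Sum>i\<in>A. f i) = (\<Sum>i\<in>A. mon_sum h (f i))"
  by (induction A rule: infinite_finite_induct) (simp_all add: mon_sum_add)

lemma poly_mapping_eq_sum_single: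
  "p = (\<Sum>k\<in>Poly_Mapping.keys p. Poly_Mapping.single k (Poly_Mapping.lookup p k))"
proof (rule poly_mapping_eqI)
  fix l
  show "Poly_Mapping.lookup p l =
    Poly_Mapping.lookup (\<Sum>k\<in>Poly_Mapping.keys p. Poly_Mapping.single k (Poly_Mapping.lookup p k)) l"
    by (cases "l \<in> Poly_Mapping.keys p")
      (auto simp: lookup_sum lookup_single when_def in_keys_iff sum.delta')
qed

lemma mon_sum_mult:
  fixes h :: "'k::monoid_add \<Rightarrow> real"
  assumes h: "\<And>k l. h (k + l) = h k * h l"
  shows "mon_sum h (p * q) = mon_sum h p * mon_sum h q"
proof -
  let ?p = "Poly_Mapping.lookup p" and ?q = "Poly_Mapping.lookup q"
  have "p * q = (\<Sum>k\<in>Poly_Mapping.keys p. Poly_Mapping.single k (?p k)) *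
      (\<Sum>l\<in>Poly_Mapping.keys q. Poly_Mapping.single l (?q l))"
    by (metis poly_mapping_eq_sum_single)
  also have "\<dots> = (\<Sum>k\<in>Poly_Mapping.keys p. \<Sum>l\<in>Poly_Mapping.keys q.
      Poly_Mapping.single (k + l) (?p k * ?q l))"
    by (simp add: sum_product mult_single)
  finally have "mon_sum h (p * q) =
      (\<Sum>k\<in>Poly_Mapping.keys p. \<Sum>l\<in>Poly_Mapping.keys q. (?p k * h k) * (?q l * h l))"
    by (simp add: mon_sum_sum h ac_simps)
  then show ?thesis
    by (simp add: mon_sum_def sum_product)
qed

lemma comm_ring_hom_mon_sum:
  fixes h :: "'k::comm_monoid_add \<Rightarrow> real"
  assumes "h 0 = 1" "\<And>k l. h (k + l) = h k * h l"
  shows "comm_ring_hom (mon_sum h)"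
proof
  show "mon_sum h 1 = 1"
    using assms(1) mon_sum_single[of h 0 1] by simp
qed (simp_all add: mon_sum_add mon_sum_mult assms(2))

lemma eval_poly_eq_mon_sum: "eval_poly p x = mon_sum (mpow x) p"
  by (simp add: eval_poly_def mon_sum_def)

lemma mpow_0 [simp]: "mpow x 0 = 1"
  by (simp add: mpow_def)

lemma mpow_add: "mpow x (k + l) = mpow x k * mpow x l"
  by (simp add: mpow_def power_add prod.distrib)

lemma mpow_axis: "mpow x (axis l 1) = x $ l"
proof -
  have "mpow x (axis l 1) = (\<Prod>j\<in>UNIV. if j = l then x $ j else 1)"
    unfolding mpow_def by (intro prod.cong) (auto simp: axis_def)
  then show ?thesis
    by simp
qed

text \<open>
  Evaluation at the points \<open>x 0, \<dots>, x s\<close>. Indeterminates with a larger index are sent to \<open>1\<close>. With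
  this choice the map is a ring homomorphism on all polynomials, and on monomials it involves exactly
  the exponents that \<open>E0\<close> with parameter \<open>s\<close> takes into account.
\<close>

definition eval_upto :: "nat \<Rightarrow> (nat \<Rightarrow> real ^ 'd) \<Rightarrow> 'd::finite polys \<Rightarrow> real" where
  "eval_upto s x = mon_sum (\<lambda>\<mu>. \<Prod>i\<le>s. mpow (x i) (Poly_Mapping.lookup \<mu> i))"

lemma comm_ring_hom_eval_upto: "comm_ring_hom (eval_upto s x)"
  unfolding eval_upto_def
  by (rule comm_ring_hom_mon_sum) (simp_all add: lookup_add mpow_add prod.distrib)

lemma eval_upto_indet:
  assumes "i \<le> s"
  shows "eval_upto s x (indet i $ l) = x i $ l"
proof -
  have "mpow (x j) (Poly_Mapping.lookup (Poly_Mapping.single i (axis l 1)) j) =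
      (if j = i then x i $ l else 1)" for j
    by (simp add: lookup_single when_def mpow_axis del: One_nat_def)
  then have "eval_upto s x (indet i $ l) = (\<Prod>j\<le>s. if j = i then x i $ l else 1)"
    by (simp add: eval_upto_def indet_def del: One_nat_def)
  then show ?thesis
    using assms by simp
qed

section \<open>The determinants under ring homomorphisms\<close>

lemma (in comm_ring_hom) hom_mpow:
  assumes "\<And>l. hom (y $ l) = x $ l"
  shows "hom (mpow y k) = mpow x k"
  by (simp add: mpow_def hom_prod hom_power assms)

lemma (in comm_ring_hom) hom_Delta:
  assumes "\<And>i l. i \<le> box_card n - 1 \<Longrightarrow> hom (y i $ l) = x i $ l"
  shows "hom (Delta e n y) = Delta e n x"
  unfolding Delta_def Let_def hom_det[symmetric]
  by (intro arg_cong[where f = Determinant.det] eq_matI) (auto intro!: hom_mpow assms)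

lemma (in comm_ring_hom) hom_Delta_star:
  assumes "\<And>i l. 1 \<le> i \<Longrightarrow> i \<le> box_card n - 1 \<Longrightarrow> hom (y i $ l) = x i $ l"
  shows "hom (Delta_star e n y) = Delta_star e n x"
  unfolding Delta_star_def Let_def hom_det[symmetric]
  by (intro arg_cong[where f = Determinant.det] eq_matI) (auto intro!: hom_mpow assms)

lemma box_card_mono:
  assumes "enumerates_box f n" "k \<le> n"
  shows "box_card k \<le> box_card n"
proof -
  have "finite {k. 0 \<le> k \<and> k \<le> n}"
    using assms(1) bij_betw_finite unfolding enumerates_box_def by blast
  then show ?thesis
    unfolding box_card_def using assms(2) by (intro card_mono) auto
qed

section \<open>The operator as an integral\<close>

text \<open>
  On a single monomial the integrand is a product of functions of one tuple each, whose integrals are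
  the moments in the definition of \<open>E0\<close>. The exponents of the tuple \<open>0\<close> only contribute a constant,
  since \<open>x\<^sub>0\<close> is not integrated. That each factor is integrable, including the weight alone (a tuple
  absent from the monomial has exponent \<open>0\<close>), is the existence of the moments.
\<close>

lemma E0_eq_integral:
  fixes \<omega> :: "nat \<Rightarrow> real ^ 'd \<Rightarrow> real" and P :: "nat \<Rightarrow> nat set" and s :: nat
  assumes moments_exist: "\<And>j k. integrable lebesgue (\<lambda>t. mpow t k * \<omega> j t)"
    and a: "\<And>j k. a j k = moment (\<omega> j) k"
  defines "F \<equiv> \<lambda>q x\<^sub>0 x. eval_upto s (x(0 := x\<^sub>0)) q * (\<Prod>i=1..s. \<omega> (class_index P i) (x i))"
  shows "integrable (lebesgue_power s) (F q x\<^sub>0)"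
    and "eval_poly (E0 a P s q) x\<^sub>0 = integral\<^sup>L (lebesgue_power s) (F q x\<^sub>0)"
proof -
  interpret product_sigma_finite "\<lambda>_::nat. lborel :: (real ^ 'd) measure"
    by standard
  let ?f = "\<lambda>\<mu> i t. mpow t (Poly_Mapping.lookup \<mu> i) * \<omega> (class_index P i) t"
  let ?c = "\<lambda>\<mu>. Poly_Mapping.lookup q \<mu> * mpow x\<^sub>0 (Poly_Mapping.lookup \<mu> 0)"
  let ?T = "\<lambda>\<mu> x. \<Prod>i=1..s. ?f \<mu> i (x i)"
  have T: "integrable (lebesgue_power s) (?T \<mu>)"
    "integral\<^sup>L (lebesgue_power s) (?T \<mu>) = (\<Prod>i=1..s. a (class_index P i) (Poly_Mapping.lookup \<mu> i))"
    for \<mu>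
    using product_integral_prod_completion[of "{1..s}" "?f \<mu>"] moments_exist
    by (simp_all add: lebesgue_power_def a moment_def)
  have split: "{..s} = insert 0 {1..s}"
    by auto
  have F: "F q x\<^sub>0 = (\<lambda>x. \<Sum>\<mu>\<in>Poly_Mapping.keys q. ?c \<mu> * ?T \<mu> x)"
    by (auto simp: F_def eval_upto_def mon_sum_def split sum_distrib_right prod.distrib mult.assoc
        intro!: sum.cong prod.cong)
  show "integrable (lebesgue_power s) (F q x\<^sub>0)"
    unfolding F by (intro Bochner_Integration.integrable_sum integrable_mult_right T(1))
  have "integral\<^sup>L (lebesgue_power s) (F q x\<^sub>0) = (\<Sum>\<mu>\<in>Poly_Mapping.keys q. ?c \<mu> *
      (\<Prod>i=1..s. a (class_index P i) (Poly_Mapping.lookup \<mu> i)))"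
    unfolding F by (subst Bochner_Integration.integral_sum) (simp_all only: T integrable_mult_right integral_mult_right_zero)
  then show "eval_poly (E0 a P s q) x\<^sub>0 = integral\<^sup>L (lebesgue_power s) (F q x\<^sub>0)"
    by (simp add: eval_poly_eq_mon_sum E0_def mon_sum_sum ac_simps)
qed

theorem corollary12:
  fixes \<omega> :: "nat \<Rightarrow> real ^ 'd \<Rightarrow> real"
    and a :: "nat \<Rightarrow> nat ^ 'd \<Rightarrow> real"
    and e :: "nat ^ 'd \<Rightarrow> nat \<Rightarrow> nat ^ 'd"
    and P :: "nat ^ 'd \<Rightarrow> nat \<Rightarrow> nat set"
    and n :: "nat ^ 'd"
  assumes moments_exist: "\<And>j k. integrable lebesgue (\<lambda>t. mpow t k * \<omega> j t)"
    and a_def: "\<And>j k. a j k = moment (\<omega> j) k"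
    and a01: "\<And>k. a 0 k = a 1 k"
    and enum: "\<And>k. enumerates_box (e k) k"
    and part: "\<And>m. 0 < m \<Longrightarrow> m \<le> n \<Longrightarrow> class_partition (P m)"
    and class1: "\<And>m. 0 < m \<Longrightarrow> m \<le> n \<Longrightarrow> {1..box_card (n - m) - 1} \<subseteq> P m 1"
    and deg: "\<And>m. 0 < m \<Longrightarrow> m \<le> n \<Longrightarrow> of_degree (p_poly e a (P m) n m) n"
  shows "\<forall>m. 0 < m \<and> m \<le> n \<longrightarrow> (let s = box_card n - 1 in
    \<forall>x\<^sub>0 :: real ^ 'd.
      integrable (lebesgue_power s)
        (\<lambda>x. Delta_star e (n - m) x * Delta e n (x(0 := x\<^sub>0)) *
             (\<Prod>i=1..s. \<omega> (class_index (P m) i) (x i))) \<and>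
      eval_poly (p_poly e a (P m) n m) x\<^sub>0 =
        (LINT x|lebesgue_power s.
           Delta_star e (n - m) x * Delta e n (x(0 := x\<^sub>0)) *
             (\<Prod>i=1..s. \<omega> (class_index (P m) i) (x i))))"
proof (intro allI impI)
  fix m :: "nat ^ 'd"
  assume "0 < m \<and> m \<le> n"
  define s where "s = box_card n - 1"
  let ?q = "Delta_star e (n - m) indet * Delta e n indet"
  \<comment> \<open>The box of \<open>n - m\<close> lies in that of \<open>n\<close>, so every tuple of the reduced determinant is evaluated.\<close>
  have "n - m \<le> n"
    by (simp add: Finite_Cartesian_Product.less_eq_vec_def)
  then have "box_card (n - m) \<le> box_card n"
    by (rule box_card_mono[OF enum])
  then have rs: "box_card (n - m) - 1 \<le> s"
    by (simp add: s_def)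
  have ev: "eval_upto s (x(0 := x\<^sub>0)) ?q = Delta_star e (n - m) x * Delta e n (x(0 := x\<^sub>0))"
    for x :: "nat \<Rightarrow> real ^ 'd" and x\<^sub>0
  proof -
    interpret comm_ring_hom "eval_upto s (x(0 := x\<^sub>0))"
      by (rule comm_ring_hom_eval_upto)
    have "eval_upto s (x(0 := x\<^sub>0)) (Delta e n indet) = Delta e n (x(0 := x\<^sub>0))"
      by (rule hom_Delta) (simp only: eval_upto_indet s_def)
    moreover have "eval_upto s (x(0 := x\<^sub>0)) (Delta_star e (n - m) indet) = Delta_star e (n - m) x"
      using rs by (intro hom_Delta_star) (simp add: eval_upto_indet)
    ultimately show ?thesis
      by (simp add: hom_mult)
  qed
  show "let s = box_card n - 1 in
    \<forall>x\<^sub>0 :: real ^ 'd.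
      integrable (lebesgue_power s)
        (\<lambda>x. Delta_star e (n - m) x * Delta e n (x(0 := x\<^sub>0)) *
             (\<Prod>i=1..s. \<omega> (class_index (P m) i) (x i))) \<and>
      eval_poly (p_poly e a (P m) n m) x\<^sub>0 =
        (LINT x|lebesgue_power s.
           Delta_star e (n - m) x * Delta e n (x(0 := x\<^sub>0)) *
             (\<Prod>i=1..s. \<omega> (class_index (P m) i) (x i)))"
    using E0_eq_integral[where \<omega> = \<omega> and a = a and s = s and P = "P m" and q = ?q,
        OF moments_exist a_def]
    unfolding Let_def p_poly_def s_def[symmetric] ev by blast
qed

end
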